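(* Let $a\ge 2$ and let $D$ be a strong balanced bipartite digraph on $2a$ vertices. Suppose that for every dominating pair of vertices $\{x,y\}$ in $D$, either $d(x)\ge 2a-1$ and $d(y)\ge a+1$, or $d(y)\ge 2a-1$ and $d(x)\ge a+1$. Then $D$ is hamiltonian.
   Context: Digraphs are finite, without loops and without multiple arcs (both arcs $xy$ and $yx$ may be present). Write $x\rightarrow y$ if there is an arc from $x$ to $y$. A digraph is bipartite if its vertex set is a disjoint union of two independent sets $V_1,V_2$ (the partite sets), and balanced if $|V_1|=|V_2|$. It is strong if for every two vertices $x,y$ there is a directed path from $x$ to $y$. A pair $\{x,y\}$ of distinct vertices is dominating if there is a vertex $z$ with $x\rightarrow z$ and $y\rightarrow z$. The degree of a vertex $v$ is $d(v)=d^+(v)+d^-(v)$, the sum of its out-degree and in-degree in $D$. $D$ is hamiltonian if it contains a directed cycle through every vertex of $D$. *)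

theory Defs
  imports "Graph_Theory.Graph_Theory"
begin

definition independent_set :: "('v, 'e) pre_digraph \<Rightarrow> 'v set \<Rightarrow> bool" where
  "independent_set D S \<longleftrightarrow> S \<subseteq> verts D \<and> (\<forall>x\<in>S. \<forall>y\<in>S. \<not> x \<rightarrow>\<^bsub>D\<^esub> y)"

definition partite_sets :: "('v, 'e) pre_digraph \<Rightarrow> 'v set \<Rightarrow> 'v set \<Rightarrow> bool" where
  "partite_sets D V1 V2 \<longleftrightarrow>
     verts D = V1 \<union> V2 \<and> V1 \<inter> V2 = {} \<and> independent_set D V1 \<and> independent_set D V2"

definition balanced_bipartite :: "('v, 'e) pre_digraph \<Rightarrow> bool" where
  "balanced_bipartite D \<longleftrightarrow> (\<exists>V1 V2. partite_sets D V1 V2 \<and> card V1 = card V2)"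

definition dominating_pair :: "('v, 'e) pre_digraph \<Rightarrow> 'v \<Rightarrow> 'v \<Rightarrow> bool" where
  "dominating_pair D x y \<longleftrightarrow>
     x \<in> verts D \<and> y \<in> verts D \<and> x \<noteq> y \<and> (\<exists>z\<in>verts D. x \<rightarrow>\<^bsub>D\<^esub> z \<and> y \<rightarrow>\<^bsub>D\<^esub> z)"

definition vertex_degree :: "('v, 'e) pre_digraph \<Rightarrow> 'v \<Rightarrow> nat" where
  "vertex_degree D v = out_degree D v + in_degree D v"

text \<open>The vertex list of a closed arc walk from \<open>u\<close> contains \<open>u\<close> at both ends;
  that the remaining vertices are distinct is part of the library's notion of a cycle.\<close>

definition hamiltonian :: "('v, 'e) pre_digraph \<Rightarrow> bool" where
  "hamiltonian D \<longleftrightarrow>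
     (\<exists>u p. pre_digraph.cycle D p \<and> pre_digraph.awalk D u p u \<and>
        set (pre_digraph.awalk_verts D u p) = verts D)"

end

theory Submission
  imports Defs
begin

text \<open>
  Call a vertex big if its degree is at least \<open>2a - 1\<close>, so that it misses at most one of the
  possible arcs, and small otherwise. Two small vertices never dominate a common vertex.
  A perfect matching from each side to the other is obtained by exchanges, which gives a cycle factor
  \<open>f\<close> (with \<open>v \<rightarrow> f v\<close>). Take one with as few \<open>f\<close>-closed vertex sets as possible: if \<open>u\<close> and \<open>v\<close>
  lie on the same side but in different cycles, then the arcs \<open>u \<rightarrow> f v\<close> and \<open>v \<rightarrow> f u\<close> cannot both
  exist, since exchanging the successors of \<open>u\<close> and \<open>v\<close> would merge two cycles.

  Suppose that \<open>S\<close> is a proper \<open>f\<close>-closed set. If one side has two small vertices, no big vertex on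
  the other side is dominated by both, so it has all out-arcs, and merging is nearly always possible.
  Otherwise each side has at most one small vertex. A vertex of degree at most \<open>a\<close> is in no dominating
  pair, which traps it in a 2-cycle that no arc enters. If all degrees are at least \<open>a + 1\<close>, at most
  \<open>2(a - 1)\<close> arcs are missing, while with \<open>k\<close> vertices of each side in \<open>S\<close> at least \<open>2k(a - k)\<close> are;
  so \<open>S\<close> or its complement is a 2-cycle. Then all missing arcs join this 2-cycle to the rest, and the
  rest splits into a closed part with arcs only to the 2-cycle and one with arcs only from it, two
  parts whose cycles can be merged.
\<close>

section \<open>Bipartite arc relations\<close>

text \<open>Stated for a bare relation so that the combinatorial part does without arc identities.
  Without multiple arcs it agrees with \<open>vertex_degree\<close>.\<close>

definition degree_in :: "('v \<Rightarrow> 'v \<Rightarrow> bool) \<Rightarrow> 'v \<Rightarrow> nat" where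
  "degree_in E v = card {w. E v w} + card {w. E w v}"

text \<open>Strong connectivity enters as a cut condition, \<open>leaving_arc\<close>. All
  assumptions are symmetric in \<open>X\<close> and \<open>Y\<close>, so each result proved for one
  side transfers to the other by \<open>swap\<close>.\<close>

locale bipartite_arcs =
  fixes X Y :: "'v set" and E :: "'v \<Rightarrow> 'v \<Rightarrow> bool" and a :: nat
  assumes finite_X: "finite X" and finite_Y: "finite Y"
    and disjoint: "X \<inter> Y = {}"
    and card_X: "card X = a" and card_Y: "card Y = a"
    and a_ge_2: "a \<ge> 2"
    and arc_sides: "E u v \<Longrightarrow> (u \<in> X \<and> v \<in> Y) \<or> (u \<in> Y \<and> v \<in> X)"
    and leaving_arc: "S \<subseteq> X \<union> Y \<Longrightarrow> S \<noteq> {} \<Longrightarrow> S \<noteq> X \<union> Y \<Longrightarrow> \<exists>u\<in>S. \<exists>v\<in>X \<union> Y - S. E u v"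
    and dominating: "u \<noteq> v \<Longrightarrow> E u w \<Longrightarrow> E v w \<Longrightarrow>
      (degree_in E u \<ge> 2 * a - 1 \<and> degree_in E v \<ge> a + 1) \<or>
      (degree_in E v \<ge> 2 * a - 1 \<and> degree_in E u \<ge> a + 1)"
begin

abbreviation big :: "'v \<Rightarrow> bool" where
  "big v \<equiv> 2 * a - 1 \<le> degree_in E v"

lemma swap: "bipartite_arcs Y X E a"
proof (unfold_locales)
  fix S assume "S \<subseteq> Y \<union> X" "S \<noteq> {}" "S \<noteq> Y \<union> X"
  then show "\<exists>u\<in>S. \<exists>v\<in>Y \<union> X - S. E u v"
    using leaving_arc[of S] by (simp add: Un_commute)
next
  show "(u \<in> Y \<and> v \<in> X) \<or> (u \<in> X \<and> v \<in> Y)" if "E u v" for u v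
    using arc_sides[OF that] by blast
qed (use dominating finite_X finite_Y disjoint card_X card_Y a_ge_2 in blast)+

section \<open>Dominating pairs and missing arcs\<close>

lemma dominating_big: "u \<noteq> v \<Longrightarrow> E u w \<Longrightarrow> E v w \<Longrightarrow> big u \<or> big v"
  using dominating by blast

lemma dominating_degree: "u \<noteq> v \<Longrightarrow> E u w \<Longrightarrow> E v w \<Longrightarrow> degree_in E u \<ge> a + 1"
  using dominating[of u v w] a_ge_2 by auto

text \<open>Turns degree bounds into bounds on missing arcs: a big vertex misses at most one, a
  vertex of degree at least \<open>a + 1\<close> at most \<open>a - 1\<close>.\<close>

lemma card_miss:
  assumes "x \<in> X"
  shows "card {y \<in> Y. \<not> E x y} + card {y \<in> Y. \<not> E y x} + degree_in E x = 2 * a"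
proof -
  have out: "{w. E x w} = {y \<in> Y. E x y}" and inn: "{w. E w x} = {y \<in> Y. E y x}"
    using assms arc_sides disjoint by auto
  have split: "card {y \<in> Y. P y} + card {y \<in> Y. \<not> P y} = a" for P
  proof -
    have "card {y \<in> Y. P y} + card {y \<in> Y. \<not> P y} = card ({y \<in> Y. P y} \<union> {y \<in> Y. \<not> P y})"
      using finite_Y by (subst card_Un_disjoint) auto
    also have "{y \<in> Y. P y} \<union> {y \<in> Y. \<not> P y} = Y" by auto
    finally show ?thesis using card_Y by simp
  qed
  show ?thesis
    unfolding degree_in_def out inn using split[of "E x"] split[of "\<lambda>y. E y x"] by simp
qed

lemma
  assumes x: "x \<in> X" and big: "big x" and y: "y \<in> Y" and y': "y' \<in> Y"
  shows big_miss_out: "\<not> E x y \<Longrightarrow> \<not> E x y' \<Longrightarrow> y = y'"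
    and big_miss_out_in: "\<not> E x y \<Longrightarrow> E y' x"
proof -
  have le: "card {y \<in> Y. \<not> E x y} + card {y \<in> Y. \<not> E y x} \<le> 1"
    using card_miss[OF x] big by linarith
  have fin: "finite {y \<in> Y. P y}" for P using finite_Y by simp
  show "y = y'" if "\<not> E x y" "\<not> E x y'"
    using that y y' le card_le_Suc0_iff_eq[OF fin[of "\<lambda>y. \<not> E x y"]] by auto
  show "E y' x" if "\<not> E x y"
  proof (rule ccontr)
    assume "\<not> E y' x"
    then have "card {y \<in> Y. \<not> E x y} > 0" "card {y \<in> Y. \<not> E y x} > 0"
      using that y y' fin by (auto simp: card_gt_0_iff)
    then show False using le by linarith
  qed
qed

section \<open>Perfect matchings and cycle factors\<close>

lemma out_arc: "v \<in> X \<Longrightarrow> \<exists>w\<in>Y. E v w"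
proof -
  assume v: "v \<in> X"
  have "\<not> Y \<subseteq> {v}" using card_mono[of "{v}" Y] card_Y a_ge_2 by auto
  then have "{v} \<noteq> X \<union> Y" by auto
  then show ?thesis using leaving_arc[of "{v}"] v arc_sides disjoint by auto
qed

text \<open>An arc that leaves the set of all vertices other than \<open>v\<close> must end in
  \<open>v\<close>.\<close>

lemma in_arc: "v \<in> X \<Longrightarrow> \<exists>w\<in>Y. E w v"
proof -
  assume v: "v \<in> X"
  have "\<not> Y \<subseteq> {v}" using card_mono[of "{v}" Y] card_Y a_ge_2 by auto
  then have "X \<union> Y - {v} \<noteq> {}" by auto
  then show ?thesis using leaving_arc[of "X \<union> Y - {v}"] v arc_sides disjoint by blast
qed

text \<open>
  A big unmatched \<open>x\<close> misses only \<open>g x\<close>, so it can trade partners with any in-neighbour of \<open>g x\<close>.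
  A small unmatched \<open>x\<close> takes an out-neighbour from its owner \<open>x'\<close>; if this leaves \<open>x'\<close> newly
  unmatched, then \<open>x'\<close> is big and the first case applies.
\<close>

lemma ex_bij_improve:
  assumes g: "bij_betw g X Y" and x: "x \<in> X" "\<not> E x (g x)"
  shows "\<exists>g'. bij_betw g' X Y \<and> card {v \<in> X. E v (g v)} < card {v \<in> X. E v (g' v)}"
proof -
  have bij: "bij_betw (h \<circ> Transposition.transpose u v) X Y"
    if "u \<in> X" "v \<in> X" "bij_betw h X Y" for u v h
    using bij_betw_trans[OF permutes_imp_bij[OF permutes_swap_id[OF that(1,2)]] that(3)] .
  have fin: "finite {v \<in> X. P v}" for P using finite_X by simp
  have big_case: "\<exists>g'. bij_betw g' X Y \<and> card {v \<in> X. E v (h v)} < card {v \<in> X. E v (g' v)}"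
    if h: "bij_betw h X Y" and z: "z \<in> X" "\<not> E z (h z)" "big z" for h z
  proof -
    have hz: "h z \<in> Y" using h z by (auto simp: bij_betw_def)
    obtain x' where x': "x' \<in> X" "E x' (h z)"
      using bipartite_arcs.in_arc[OF swap hz] by auto
    have ne: "x' \<noteq> z" using x' z by auto
    then have hx': "h x' \<noteq> h z" "h x' \<in> Y" using h x' z by (auto simp: bij_betw_def inj_on_def)
    then have "E z (h x')" using big_miss_out[OF z(1,3) hz hx'(2) z(2)] by metis
    then have "{v \<in> X. E v (h v)} \<subset> {v \<in> X. E v ((h \<circ> Transposition.transpose z x') v)}"
      using x' z ne by (auto simp: Transposition.transpose_def)
    then have "card {v \<in> X. E v (h v)} < card {v \<in> X. E v ((h \<circ> Transposition.transpose z x') v)}"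
      by (rule psubset_card_mono[OF fin])
    then show ?thesis using bij[OF z(1) x'(1) h] by (intro exI conjI)
  qed
  show ?thesis
  proof (cases "big x")
    case True
    then show ?thesis using big_case[OF g x] by blast
  next
    case False
    obtain y' where y': "y' \<in> Y" "E x y'" using out_arc x by auto
    then obtain x' where x': "x' \<in> X" "g x' = y'" using g by (auto simp: bij_betw_def)
    have ne: "x' \<noteq> x" using x' x y' by auto
    let ?h = "g \<circ> Transposition.transpose x x'"
    have h: "bij_betw ?h X Y" using bij[OF x(1) x'(1) g] .
    have hv: "?h x = y'" "?h x' = g x" "\<And>v. v \<noteq> x \<Longrightarrow> v \<noteq> x' \<Longrightarrow> ?h v = g v"
      using x' by auto
    show ?thesis
    proof (cases "E x' (g x) \<or> \<not> E x' y'")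
      case True
      have "E v (?h v)" if "E v (g v)" "v \<in> X" for v
        using that True x' x y' hv by (metis (no_types, lifting))
      moreover have "x \<in> {v \<in> X. E v (?h v)} - {v \<in> X. E v (g v)}" using x y' hv by auto
      ultimately have "{v \<in> X. E v (g v)} \<subset> {v \<in> X. E v (?h v)}" by blast
      then have "card {v \<in> X. E v (g v)} < card {v \<in> X. E v (?h v)}"
        by (rule psubset_card_mono[OF fin])
      then show ?thesis using h by (intro exI conjI)
    next
      case F: False
      then have bx': "big x'" using dominating_big[OF ne _ y'(2)] False by auto
      \<comment> \<open>\<open>x\<close> becomes matched and \<open>x'\<close> unmatched, so the
        count is the same and any improvement of \<open>?h\<close> also improves
        \<open>g\<close>.\<close>
      have eq: "{v \<in> X. E v (?h v)} = insert x ({v \<in> X. E v (g v)} - {x'})"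
        using F x x' y' hv ne by (auto simp: Transposition.transpose_def)
      have "card {v \<in> X. E v (?h v)} = Suc (card ({v \<in> X. E v (g v)} - {x'}))"
        unfolding eq using fin x by (subst card_insert_disjoint) auto
      also have "\<dots> = card {v \<in> X. E v (g v)}"
        using F x' fin by (intro card_Suc_Diff1) auto
      finally have c: "card {v \<in> X. E v (?h v)} = card {v \<in> X. E v (g v)}" .
      show ?thesis using big_case[OF h x'(1) _ bx'] hv(2) F c by simp
    qed
  qed
qed

text \<open>A bijection that uses the most arcs cannot be improved, so all its pairs are
  arcs.\<close>

lemma ex_matching: "\<exists>g. bij_betw g X Y \<and> (\<forall>v\<in>X. E v (g v))"
proof -
  let ?P = "\<lambda>g. bij_betw g X Y" and ?m = "\<lambda>g. card {v \<in> X. E v (g v)}"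
  obtain g0 where "?P g0"
    using finite_same_card_bij[OF finite_X finite_Y] card_X card_Y by auto
  moreover have "\<forall>g. ?P g \<longrightarrow> ?m g < Suc a"
    using card_mono[OF finite_X] card_X by (auto simp: less_Suc_eq_le)
  ultimately obtain g where "?P g" and max: "\<forall>g'. ?P g' \<longrightarrow> ?m g' \<le> ?m g"
    using ex_has_greatest_nat[of ?P g0 ?m "Suc a"] by blast
  then show ?thesis using ex_bij_improve[of g] by (meson not_le)
qed

text \<open>The successor function of disjoint directed cycles that cover all vertices. Cycles of
  length 2 are allowed.\<close>

definition cycle_factor :: "('v \<Rightarrow> 'v) \<Rightarrow> bool" where
  "cycle_factor f \<longleftrightarrow> bij_betw f X Y \<and> bij_betw f Y X \<and> (\<forall>v\<in>X \<union> Y. E v (f v))"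

lemma cycle_factor_inj:
  assumes "cycle_factor f"
  shows "inj_on f (X \<union> Y)"
proof -
  have "f ` (X - Y) \<subseteq> Y" "f ` (Y - X) \<subseteq> X" "inj_on f X" "inj_on f Y"
    using assms unfolding cycle_factor_def by (auto simp: bij_betw_def)
  then show ?thesis using disjoint unfolding inj_on_Un by blast
qed

lemma ex_cycle_factor: "\<exists>f. cycle_factor f"
proof -
  obtain g where g: "bij_betw g X Y" "\<forall>v\<in>X. E v (g v)" using ex_matching by blast
  obtain h where h: "bij_betw h Y X" "\<forall>v\<in>Y. E v (h v)"
    using bipartite_arcs.ex_matching[OF swap] by blast
  let ?f = "\<lambda>v. if v \<in> X then g v else h v"
  have "bij_betw ?f X Y" using g(1) by (simp cong: bij_betw_cong)
  moreover have "bij_betw ?f Y X"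
    using h(1) disjoint by (subst bij_betw_cong[of Y ?f h X]) auto
  ultimately show ?thesis
    using g(2) h(2) unfolding cycle_factor_def by (intro exI[of _ ?f]) auto
qed

end

section \<open>Cycle factors that cannot be merged\<close>

text \<open>For a permutation of a finite \<open>V\<close> these are the unions of cycles, so there
  are 2 to the power of the number of cycles. Counting them measures the cycles without defining
  these.\<close>

definition closed_sets :: "'v set \<Rightarrow> ('v \<Rightarrow> 'v) \<Rightarrow> 'v set set" where
  "closed_sets V f = {S. S \<subseteq> V \<and> f ` S \<subseteq> S}"

lemma closed_sets_image:
  assumes "finite V" "inj_on f V" "S \<in> closed_sets V f"
  shows "f ` S = S"
proof (rule endo_inj_surj)
  show "finite S" "f ` S \<subseteq> S" "inj_on f S"
    using assms by (auto simp: closed_sets_def intro: finite_subset inj_on_subset)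
qed

lemma closed_sets_compl:
  assumes "finite V" "inj_on f V" "f ` V \<subseteq> V" "S \<in> closed_sets V f"
  shows "V - S \<in> closed_sets V f"
proof -
  have "f ` S = S" "S \<subseteq> V" using closed_sets_image[OF assms(1,2,4)] assms(4) by (auto simp: closed_sets_def)
  then have "f ` (V - S) = f ` V - S" using inj_on_image_set_diff[OF assms(2), of V S] by auto
  then show ?thesis using assms(3) by (auto simp: closed_sets_def)
qed

text \<open>As \<open>S\<close> separates \<open>u\<close> from \<open>v\<close>, these lie in
  different cycles, and exchanging their successors merges the two. A set closed afterwards contains
  both or neither of \<open>u\<close> and \<open>v\<close>, hence was closed before;
  \<open>S\<close> itself is lost.\<close>

lemma closed_sets_transpose:
  assumes fin: "finite V" and inj: "inj_on f V" and V: "f ` V \<subseteq> V"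
    and S: "S \<in> closed_sets V f" and u: "u \<in> S" and v: "v \<in> V - S"
  shows "closed_sets V (f \<circ> Transposition.transpose u v) \<subset> closed_sets V f"
proof -
  let ?f = "f \<circ> Transposition.transpose u v"
  have C: "V - S \<in> closed_sets V f" using closed_sets_compl[OF fin inj V S] .
  \<comment> \<open>If \<open>q\<close> were not in \<open>T\<close>, then
    \<open>T \<inter> R\<close> would contain neither \<open>p\<close> nor \<open>q\<close> and so
    be closed under \<open>f\<close> itself. It contains \<open>f q\<close>, the new successor of
    \<open>p\<close>, hence by injectivity also \<open>q\<close>.\<close>
  have step: "q \<in> T" if T: "T \<in> closed_sets V ?f" and R: "R \<in> closed_sets V f"
    and q: "q \<in> R" and p: "p \<in> T" "p \<notin> R" and pq: "{p, q} = {u, v}" for T R p q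
  proof (rule ccontr)
    assume nq: "q \<notin> T"
    have fq: "?f p = f q" using pq by (auto simp: doubleton_eq_iff)
    have ff: "?f z = f z" if "z \<noteq> p" "z \<noteq> q" for z
      using that pq by (auto simp: doubleton_eq_iff Transposition.transpose_def)
    have W: "T \<inter> R \<in> closed_sets V f"
      unfolding closed_sets_def
    proof (intro CollectI conjI subsetI)
      fix w assume "w \<in> f ` (T \<inter> R)"
      then obtain z where z: "z \<in> T" "z \<in> R" "w = f z" by auto
      then have "z \<noteq> p" "z \<noteq> q" using p nq by auto
      then have "w = ?f z" using ff z(3) by metis
      then show "w \<in> T \<inter> R" using z T R by (auto simp: closed_sets_def)
    qed (use R in \<open>auto simp: closed_sets_def\<close>)
    have "f q \<in> T \<inter> R"
      using fq p T R q by (auto simp: closed_sets_def)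
    then have "f q \<in> f ` (T \<inter> R)" using closed_sets_image[OF fin inj W] by simp
    then obtain z where "z \<in> T \<inter> R" "f q = f z" by auto
    then have "q = z" using inj R q by (auto simp: inj_on_def closed_sets_def)
    then show False using nq \<open>z \<in> T \<inter> R\<close> by simp
  qed
  have "T \<in> closed_sets V f" if T: "T \<in> closed_sets V ?f" for T
  proof -
    have uv: "u \<in> T \<longleftrightarrow> v \<in> T"
      using step[OF T S u, of v] step[OF T C v, of u] u v by (auto simp: insert_commute)
    have "f z \<in> T" if z: "z \<in> T" for z
    proof (cases "z = u \<or> z = v")
      case True
      then have "u \<in> T" "v \<in> T" using z uv by auto
      then have "?f u \<in> T" "?f v \<in> T" using T by (auto simp: closed_sets_def simp del: comp_apply)
      then show ?thesis using True by auto
    next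
      case False
      then have "?f z = f z" by auto
      then show ?thesis using T z by (force simp: closed_sets_def)
    qed
    then show ?thesis using T by (auto simp: closed_sets_def)
  qed
  moreover have "S \<notin> closed_sets V ?f"
  proof
    assume A: "S \<in> closed_sets V ?f"
    show False using step[OF A C v u] u v by auto
  qed
  ultimately show ?thesis using S by blast
qed

text \<open>\<open>no_merge\<close> is what minimality of the number of closed sets yields. The
  closed set \<open>S\<close> certifies that \<open>u\<close> and \<open>v\<close> lie in different
  cycles; that they are on the same side keeps the exchanged factor bipartite.\<close>

locale stuck_factor = bipartite_arcs X Y E a
  for X Y :: "'v set" and E :: "'v \<Rightarrow> 'v \<Rightarrow> bool" and a :: nat +
  fixes f :: "'v \<Rightarrow> 'v"
  assumes factor: "cycle_factor f"
    and no_merge: "S \<in> closed_sets (X \<union> Y) f \<Longrightarrow> u \<in> S \<Longrightarrow> v \<in> X \<union> Y - S \<Longrightarrow>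
      (u \<in> X \<longleftrightarrow> v \<in> X) \<Longrightarrow> E u (f v) \<Longrightarrow> E v (f u) \<Longrightarrow> False"
begin

abbreviation closed :: "'v set \<Rightarrow> bool" where
  "closed S \<equiv> S \<in> closed_sets (X \<union> Y) f"

text \<open>Such a set exists exactly when the factor has at least two cycles.\<close>

definition proper :: "'v set \<Rightarrow> bool" where
  "proper S \<longleftrightarrow> closed S \<and> S \<noteq> {} \<and> S \<noteq> X \<union> Y"

lemma f_X: "x \<in> X \<Longrightarrow> f x \<in> Y" and f_Y: "y \<in> Y \<Longrightarrow> f y \<in> X"
  and f_arc: "v \<in> X \<union> Y \<Longrightarrow> E v (f v)"
  using factor unfolding cycle_factor_def by (auto simp: bij_betw_def)

lemma inj_f: "inj_on f (X \<union> Y)"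
  using factor by (rule cycle_factor_inj)

lemma f_eqD: "f u = f v \<Longrightarrow> u \<in> X \<union> Y \<Longrightarrow> v \<in> X \<union> Y \<Longrightarrow> u = v"
  using inj_f by (auto simp: inj_on_def)

lemma swap_stuck: "stuck_factor Y X E a f"
proof -
  interpret sw: bipartite_arcs Y X E a by (rule swap)
  show ?thesis
  proof
    show "bipartite_arcs.cycle_factor Y X E f"
      using factor unfolding cycle_factor_def sw.cycle_factor_def by auto
    show False if "S \<in> closed_sets (Y \<union> X) f" "u \<in> S" "v \<in> Y \<union> X - S"
      "(u \<in> Y) = (v \<in> Y)" "E u (f v)" "E v (f u)" for S u v
    proof (rule no_merge[of S u v])
      show "(u \<in> X) = (v \<in> X)"
        using that disjoint by (auto simp: closed_sets_def)
    qed (use that in \<open>auto simp: Un_commute\<close>)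
  qed
qed

lemma proper_swap: "stuck_factor.proper Y X f S \<longleftrightarrow> proper S"
  by (simp add: stuck_factor.proper_def[OF swap_stuck] proper_def Un_commute)

lemma closed_subset: "closed S \<Longrightarrow> S \<subseteq> X \<union> Y"
  and closed_f: "closed S \<Longrightarrow> v \<in> S \<Longrightarrow> f v \<in> S"
  by (auto simp: closed_sets_def)

lemma closed_image: "closed S \<Longrightarrow> f ` S = S"
  using closed_sets_image[OF _ inj_f] finite_X finite_Y by auto

lemma closed_compl: "closed S \<Longrightarrow> closed (X \<union> Y - S)"
  using closed_sets_compl[OF _ inj_f] finite_X finite_Y f_X f_Y by blast

lemma proper_compl: "proper S \<Longrightarrow> proper (X \<union> Y - S)"
  using closed_compl closed_subset unfolding proper_def by blast

lemma closed_f_notin: "closed S \<Longrightarrow> v \<in> X \<union> Y \<Longrightarrow> v \<notin> S \<Longrightarrow> f v \<notin> S"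
  using closed_f[OF closed_compl] by blast

lemma closed_preimage:
  assumes "closed S" "y \<in> Y"
  obtains x where "x \<in> X" "f x = y" "x \<in> S \<longleftrightarrow> y \<in> S"
proof -
  obtain x where x: "x \<in> X" "f x = y"
    using factor assms unfolding cycle_factor_def bij_betw_def by blast
  then show ?thesis
    using that closed_f[OF assms(1)] closed_f_notin[OF assms(1), of x] by blast
qed

lemma no_merge':
  assumes "closed S" "u \<in> X" "v \<in> X" "u \<in> S \<longleftrightarrow> v \<notin> S" "E u (f v)" "E v (f u)"
  shows False
  using assms no_merge[of S u v] no_merge[of S v u] by auto

lemma proper_meets:
  assumes "proper S"
  obtains u v where "u \<in> S" "u \<in> X" "v \<notin> S" "v \<in> X"
proof -
  have "\<exists>u\<in>T. u \<in> X" if T: "proper T" for T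
  proof -
    obtain t where t: "t \<in> T" "t \<in> X \<union> Y" using T closed_subset by (auto simp: proper_def)
    then show ?thesis using closed_f[of T t] T f_Y[of t] by (auto simp: proper_def)
  qed
  from this[OF assms] this[OF proper_compl[OF assms]] show ?thesis using that by auto
qed

section \<open>Two small vertices on one side\<close>

text \<open>A big \<open>x\<close> that misses an out-arc has all in-arcs, so the small
  \<open>y1\<close> and \<open>y2\<close> would both dominate \<open>x\<close>.\<close>

lemma big_full_out:
  assumes "x \<in> X" "big x" "y \<in> Y"
    and "y1 \<in> Y" "y2 \<in> Y" "y1 \<noteq> y2" "\<not> big y1" "\<not> big y2"
  shows "E x y"
proof (rule ccontr)
  assume "\<not> E x y"
  then have "E y1 x" "E y2 x" using big_miss_out_in assms by auto
  then show False using dominating_big assms by blast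
qed

lemma closed_single:
  assumes "closed S" "S \<inter> X = {u}"
  shows "f (f u) = u" and "S = {u, f u}"
proof -
  have u: "u \<in> S" "u \<in> X" using assms by auto
  have "f (f u) \<in> S \<inter> X" using closed_f[OF assms(1)] u f_X f_Y by auto
  then show ffu: "f (f u) = u" using assms by auto
  have "y = f u" if y: "y \<in> S" "y \<in> Y" for y
  proof -
    obtain x where "x \<in> X" "f x = y" "x \<in> S \<longleftrightarrow> y \<in> S"
      using closed_preimage[OF assms(1) y(2)] .
    moreover have "x = u" using calculation y assms(2) by auto
    ultimately show ?thesis by simp
  qed
  then show "S = {u, f u}"
    using assms u closed_f[OF assms(1)] closed_subset[OF assms(1)] by auto
qed

text \<open>The predecessor \<open>v\<close> of \<open>q\<close> dominates \<open>q\<close> together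
  with \<open>p\<close>. If \<open>p\<close> were small, \<open>v\<close> would be big and have all
  out-arcs, in particular the one to \<open>f p\<close>; then \<open>p\<close> and \<open>v\<close>
  could exchange successors.\<close>

lemma two_small_cross_arc:
  assumes "closed S" and small: "x1 \<in> X" "x2 \<in> X" "x1 \<noteq> x2" "\<not> big x1" "\<not> big x2"
      "y1 \<in> Y" "y2 \<in> Y" "y1 \<noteq> y2" "\<not> big y1" "\<not> big y2"
    and p: "p \<in> X" "q \<in> Y" "E p q" "p \<in> S \<longleftrightarrow> q \<notin> S"
  shows "big p"
proof (rule ccontr)
  assume np: "\<not> big p"
  obtain v where v: "v \<in> X" "f v = q" "v \<in> S \<longleftrightarrow> q \<in> S"
    using closed_preimage[OF assms(1) p(2)] .
  have ne: "v \<noteq> p" using v p by auto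
  then have "big v" using dominating_big[OF ne _ p(3)] f_arc[of v] v np by auto
  then have "E v (f p)" using big_full_out small v p f_X by blast
  then show False using no_merge'[of S p v] assms(1) p v by auto
qed

text \<open>
  Here \<open>S\<close> contains no big vertex of \<open>Y\<close>, and arcs leaving small vertices stay in \<open>S\<close>. The second
  out-neighbour of a small \<open>y\<close> is therefore the successor of another small vertex of \<open>Y\<close>.
\<close>

lemma two_small_aux:
  assumes S: "proper S" and small: "x1 \<in> X" "x2 \<in> X" "x1 \<noteq> x2" "\<not> big x1" "\<not> big x2"
      "y1 \<in> Y" "y2 \<in> Y" "y1 \<noteq> y2" "\<not> big y1" "\<not> big y2"
    and p: "p \<in> S" "p \<in> X" "big p" and q: "q \<notin> S" "q \<in> Y" "big q"
  shows False
proof -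
  interpret sw: stuck_factor Y X E a f by (rule swap_stuck)
  have cl: "closed S" and cl': "sw.closed S" using S by (auto simp: proper_def Un_commute)
  have full: "E y x" if "y \<in> Y" "big y" "x \<in> X" for x y
    using sw.big_full_out[OF that small(1-5)] .
  have small_S: "\<not> big y" if y: "y \<in> Y" "y \<in> S" for y
  proof
    assume "big y"
    then show False
      using sw.no_merge'[OF cl', of y q] y q full[of y "f q"] full[of q "f y"] f_Y by auto
  qed
  define y where "y = f p"
  have y: "y \<in> Y" "y \<in> S" using p f_X closed_f[OF cl] by (auto simp: y_def)
  have deg: "degree_in E y \<ge> a + 1"
    using dominating_degree[of y q "f y"] f_arc[of y] full[of q "f y"] y q f_Y by auto
  \<comment> \<open>Some in-arc of \<open>y\<close> is missing, so its degree leaves at most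
    \<open>a - 2\<close> missing out-arcs and hence a second out-neighbour besides
    \<open>f y\<close>.\<close>
  have "\<not> (E x1 y \<and> E x2 y)" using dominating_big small by blast
  then have "{x \<in> X. \<not> E x y} \<noteq> {}" using small by auto
  then have "card {x \<in> X. \<not> E x y} \<ge> 1" using finite_X by (simp add: Suc_le_eq card_gt_0_iff)
  then have few: "card {x \<in> X. \<not> E y x} + 2 \<le> a" using sw.card_miss[OF y(1)] deg by linarith
  have "\<exists>x\<in>X. x \<noteq> f y \<and> E y x"
  proof (rule ccontr)
    assume "\<not> ?thesis"
    then have "X - {f y} \<subseteq> {x \<in> X. \<not> E y x}" by auto
    then have "card (X - {f y}) \<le> card {x \<in> X. \<not> E y x}" using finite_X by (intro card_mono) auto
    then show False using few f_Y[OF y(1)] card_X finite_X by simp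
  qed
  then obtain x where x: "x \<in> X" "x \<noteq> f y" "E y x" by blast
  have "x \<in> S"
    using sw.two_small_cross_arc[OF cl' small(6-10) small(1-5) y(1) x(1,3)] y small_S by blast
  moreover obtain y' where "y' \<in> Y" "f y' = x" "y' \<in> S \<longleftrightarrow> x \<in> S"
    using sw.closed_preimage[OF cl' x(1)] .
  ultimately show False
    using small_S[of y] small_S[of y'] dominating_big[of y y' x] f_arc[of y'] x y by auto
qed

text \<open>Arcs that cross between \<open>S\<close> and its complement start in big vertices, and
  there are such arcs in both directions. This gives a big vertex in each part. On the same side of
  the bipartition they merge two cycles, since both have all out-arcs; on opposite sides
  \<open>two_small_aux\<close> applies.\<close>

lemma two_small_both_sides:
  assumes S: "proper S" and small: "x1 \<in> X" "x2 \<in> X" "x1 \<noteq> x2" "\<not> big x1" "\<not> big x2"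
      "y1 \<in> Y" "y2 \<in> Y" "y1 \<noteq> y2" "\<not> big y1" "\<not> big y2"
  shows False
proof -
  interpret sw: stuck_factor Y X E a f by (rule swap_stuck)
  have cl: "closed S" and cl': "sw.closed S" using S by (auto simp: proper_def Un_commute)
  have cross: "big p" if "E p q" "p \<in> S \<longleftrightarrow> q \<notin> S" for p q
    using two_small_cross_arc[OF cl small _ _ that] arc_sides[OF that(1)]
      sw.two_small_cross_arc[OF cl' small(6-10) small(1-5) _ _ that] by blast
  have ex: "\<exists>p\<in>T. big p" if T: "proper T" "T = S \<or> T = X \<union> Y - S" for T
  proof -
    obtain p q where "p \<in> T" "q \<in> X \<union> Y - T" "E p q"
      using leaving_arc[of T] T closed_subset[of T] by (auto simp: proper_def)
    then show ?thesis using cross[of p q] T(2) by blast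
  qed
  obtain p where p: "p \<in> S" "big p" using ex S by blast
  obtain q where q: "q \<in> X \<union> Y - S" "big q" using ex proper_compl[OF S] by blast
  have pV: "p \<in> X \<union> Y" using p closed_subset[OF cl] by auto
  have fullX: "E x y" if "x \<in> X" "big x" "y \<in> Y" for x y
    using big_full_out[OF that small(6-10)] .
  have fullY: "E y x" if "y \<in> Y" "big y" "x \<in> X" for x y
    using sw.big_full_out[OF that small(1-5)] .
  consider "p \<in> X" "q \<in> X" | "p \<in> Y" "q \<in> Y" | "p \<in> X" "q \<in> Y" | "p \<in> Y" "q \<in> X"
    using pV q by auto
  then show False
  proof cases
    case 1
    then show False using no_merge'[OF cl, of p q] p q fullX f_X by auto
  next
    case 2
    then show False using sw.no_merge'[OF cl', of p q] p q fullY f_Y by auto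
  next
    case 3
    then show False using two_small_aux[OF S small] p q by auto
  next
    case 4
    then show False using two_small_aux[OF proper_compl[OF S] small, of q p] p q by auto
  qed
qed

text \<open>All vertices of \<open>X\<close> but \<open>x0\<close> have all out-arcs, so
  \<open>S\<close> meets \<open>X\<close> only in \<open>x0\<close>, and a second out-arc of
  \<open>x0\<close> would allow a merge. With \<open>f x0\<close> as its only out-neighbour and
  degree at least \<open>a + 1\<close>, \<open>x0\<close> is dominated by everything in
  \<open>Y\<close>, also by the small pair.\<close>

lemma one_small_aux:
  assumes S: "proper S" and uniq: "\<And>x. x \<in> X \<Longrightarrow> x \<noteq> x0 \<Longrightarrow> big x"
    and small: "y1 \<in> Y" "y2 \<in> Y" "y1 \<noteq> y2" "\<not> big y1" "\<not> big y2"
    and x0: "x0 \<in> S" "x0 \<in> X"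
  shows False
proof -
  have cl: "closed S" using S by (auto simp: proper_def)
  have full: "E x y" if "x \<in> X" "x \<noteq> x0" "y \<in> Y" for x y
    using big_full_out[OF that(1) _ that(3) small] uniq that by auto
  obtain v where v: "v \<notin> S" "v \<in> X" using proper_meets[OF S] .
  have "u = x0" if u: "u \<in> S" "u \<in> X" for u
  proof (rule ccontr)
    assume "u \<noteq> x0"
    then have "E u (f v)" "E v (f u)" using full[of u "f v"] full[of v "f u"] u v x0 f_X by auto
    then show False using no_merge'[OF cl u(2) v(2)] u v by blast
  qed
  then have Sx: "S \<inter> X = {x0}" using x0 by blast
  have out: "y = f x0" if y: "E x0 y" for y
  proof -
    have "y \<in> Y" using y x0 arc_sides disjoint by blast
    then obtain z where z: "z \<in> X" "f z = y" using closed_preimage[OF cl] by blast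
    have "z = x0"
      using no_merge'[OF cl, of x0 z] full[of z "f x0"] x0 z Sx y f_X by auto
    then show ?thesis using z by simp
  qed
  have "degree_in E x0 \<ge> a + 1"
    using dominating_degree[of x0 v "f x0"] full[of v "f x0"] v x0 f_arc f_X by auto
  moreover have "card (Y - {f x0}) \<le> card {y \<in> Y. \<not> E x0 y}"
    using out finite_Y by (intro card_mono) auto
  moreover have "card (Y - {f x0}) = a - 1" using card_Y finite_Y f_X[OF x0(2)] by simp
  ultimately have "card {y \<in> Y. \<not> E y x0} = 0" using card_miss[OF x0(2)] a_ge_2 by linarith
  then have "E y1 x0" "E y2 x0" using finite_Y small by auto
  then show False using dominating_big small by blast
qed

lemma one_small_two_small:
  assumes S: "proper S" and uniq: "\<And>x. x \<in> X \<Longrightarrow> x \<noteq> x0 \<Longrightarrow> big x"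
    and small: "y1 \<in> Y" "y2 \<in> Y" "y1 \<noteq> y2" "\<not> big y1" "\<not> big y2" and x0: "x0 \<in> X"
  shows False
  using one_small_aux[OF S uniq small _ x0] one_small_aux[OF proper_compl[OF S] uniq small _ x0] x0
  by blast

section \<open>A vertex of degree at most a\<close>

text \<open>\<open>x0\<close> is in no dominating pair, so no other vertex has an arc to
  \<open>w = f x0\<close>. That is the only missing arc of each other vertex of \<open>X\<close>,
  which forces \<open>S\<close> to be the 2-cycle on \<open>x0\<close> and \<open>w\<close>. No arc
  can enter it, against strong connectivity.\<close>

lemma low_degree_aux:
  assumes S: "proper S" and uniq: "\<And>x. x \<in> X \<Longrightarrow> x \<noteq> x0 \<Longrightarrow> big x"
    and x0: "x0 \<in> S" "x0 \<in> X" and low: "degree_in E x0 \<le> a"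
  shows False
proof -
  interpret sw: stuck_factor Y X E a f by (rule swap_stuck)
  have cl: "closed S" and cl': "sw.closed S" using S by (auto simp: proper_def Un_commute)
  define w where "w = f x0"
  have w: "w \<in> Y" "E x0 w" "w \<in> S" using x0 f_X f_arc closed_f[OF cl] by (auto simp: w_def)
  have miss: "\<not> E v w" if "v \<in> X" "v \<noteq> x0" for v
    using dominating_degree[of x0 v w] low w that by auto
  have out: "E v y" if "v \<in> X" "v \<noteq> x0" "y \<in> Y" "y \<noteq> w" for v y
    using big_miss_out[OF that(1) uniq that(3) w(1)] miss that by auto
  have inn: "E y v" if "v \<in> X" "v \<noteq> x0" "y \<in> Y" for v y
    using big_miss_out_in[OF that(1) uniq w(1) that(3)] miss that by auto
  obtain v where v: "v \<notin> S" "v \<in> X" using proper_meets[OF S] .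
  have ne_w: "f u \<noteq> w" if "u \<in> X" "u \<noteq> x0" for u
    using f_eqD[of u x0] that x0 by (auto simp: w_def)
  have "u = x0" if u: "u \<in> S" "u \<in> X" for u
  proof (rule ccontr)
    assume "u \<noteq> x0"
    moreover have "v \<noteq> x0" using v x0 by auto
    ultimately have "E u (f v)" "E v (f u)"
      using out[of u "f v"] out[of v "f u"] ne_w[of u] ne_w[of v] u v f_X by auto
    then show False using no_merge'[OF cl u(2) v(2)] u v by blast
  qed
  then have Sx: "S \<inter> X = {x0}" using x0 by blast
  note single = closed_single[OF cl Sx, folded w_def]
  obtain p q where pq: "p \<in> X \<union> Y - S" "q \<in> S" "E p q"
    using leaving_arc[of "X \<union> Y - S"] proper_compl[OF S] S closed_subset[OF cl]
    by (auto simp: proper_def)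
  show False
  proof (cases "q = w")
    case True
    then have "p \<in> X" using pq w arc_sides disjoint by blast
    then show False using miss[of p] pq True x0 by auto
  next
    case False
    then have q: "q = x0" using single(2) pq by auto
    then have p: "p \<in> Y" using pq x0 arc_sides disjoint by blast
    have fp: "f p \<in> X" "f p \<notin> S" using p f_Y closed_f_notin[OF cl, of p] pq by auto
    \<comment> \<open>\<open>p\<close> has an arc to \<open>x0 = f w\<close>, so with this arc
      \<open>p\<close> and \<open>w\<close> can exchange successors.\<close>
    then have "E w (f p)" using inn[of "f p" w] w x0 by auto
    then show False using sw.no_merge'[OF cl', of p w] p pq q w single by auto
  qed
qed

lemma low_degree:
  assumes S: "proper S" and uniq: "\<And>x. x \<in> X \<Longrightarrow> x \<noteq> x0 \<Longrightarrow> big x"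
    and x0: "x0 \<in> X" and low: "degree_in E x0 \<le> a"
  shows False
  using low_degree_aux[OF S uniq _ x0 low] low_degree_aux[OF proper_compl[OF S] uniq _ x0 low] x0
  by blast

section \<open>Counting the arcs that must be missing\<close>

lemma card_cross_le_miss:
  assumes cl: "closed S"
  shows "card (S \<inter> X) * card (X - S) \<le> card (SIGMA x:X. {y \<in> Y. \<not> E x y})"
proof -
  \<comment> \<open>Picks for each pair one of the two exchange arcs that is missing. It is
    injective: the missing arc determines both vertices, and whether its tail lies in
    \<open>S\<close> tells which is which.\<close>
  let ?g = "\<lambda>(u, v). if E u (f v) then (v, f u) else (u, f v)"
  have feq: "u = v" if "f u = f v" "u \<in> X" "v \<in> X" for u v
    using f_eqD[OF that(1)] that by blast
  have "inj_on ?g ((S \<inter> X) \<times> (X - S))"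
    by (auto simp: inj_on_def split: if_splits dest: feq)
  moreover have "?g ` ((S \<inter> X) \<times> (X - S)) \<subseteq> (SIGMA x:X. {y \<in> Y. \<not> E x y})"
  proof (rule image_subsetI)
    fix p assume "p \<in> (S \<inter> X) \<times> (X - S)"
    then obtain u v where "p = (u, v)" "u \<in> S" "u \<in> X" "v \<in> X" "v \<notin> S" by auto
    then show "?g p \<in> (SIGMA x:X. {y \<in> Y. \<not> E x y})"
      using no_merge'[OF cl, of u v] f_X by auto
  qed
  moreover have "finite (SIGMA x:X. {y \<in> Y. \<not> E x y})" using finite_X finite_Y by auto
  ultimately have "card ((S \<inter> X) \<times> (X - S)) \<le> card (SIGMA x:X. {y \<in> Y. \<not> E x y})"
    by (rule card_inj_on_le)
  then show ?thesis by (simp add: card_cartesian_product)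
qed

lemma card_closed_sides:
  assumes cl: "closed S"
  shows "card (S \<inter> Y) = card (S \<inter> X)"
proof -
  have "f ` (S \<inter> X) = S \<inter> Y"
    using closed_preimage[OF cl] closed_f[OF cl] f_X by blast
  moreover have "inj_on f (S \<inter> X)" using inj_f by (rule inj_on_subset) auto
  ultimately show ?thesis by (metis card_image)
qed

text \<open>Each other \<open>v\<close> in \<open>X\<close> lacks one of the exchange arcs with
  \<open>u\<close>: either the one from \<open>u\<close> to \<open>f v\<close> or the one from
  \<open>v\<close> to \<open>f u\<close>.\<close>

lemma two_cycle_miss:
  assumes cl: "closed S" and u: "S \<inter> X = {u}"
  shows "a - 1 \<le> card {y \<in> Y. \<not> E u y} + card {x \<in> X. \<not> E x (f u)}"
proof -
  have uX: "u \<in> X" "u \<in> S" using u by auto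
  have "X - {u} \<subseteq> {v \<in> X. \<not> E u (f v)} \<union> {x \<in> X. \<not> E x (f u)}"
    using no_merge'[OF cl, of u] u uX by blast
  then have "card (X - {u}) \<le> card ({v \<in> X. \<not> E u (f v)} \<union> {x \<in> X. \<not> E x (f u)})"
    using finite_X by (intro card_mono) auto
  also have "\<dots> \<le> card {v \<in> X. \<not> E u (f v)} + card {x \<in> X. \<not> E x (f u)}" by (rule card_Un_le)
  also have "card {v \<in> X. \<not> E u (f v)} \<le> card {y \<in> Y. \<not> E u y}"
    using f_X finite_Y by (intro card_inj_on_le[of f] inj_on_subset[OF inj_f]) auto
  finally show ?thesis using card_X uX finite_X by simp
qed

section \<open>A cycle of length 2 in the factor\<close>

text \<open>The arc from \<open>u\<close> to \<open>f p\<close> would allow a merge. Its absence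
  uses up the one arc that the big \<open>f p\<close> may miss, so \<open>f p\<close> has the arc to
  \<open>u\<close>. Thus having an arc into the 2-cycle is passed on along \<open>f\<close>.\<close>

lemma two_cycle_step:
  assumes cl: "closed S" and u: "S \<inter> X = {u}" and big: "\<And>z. z \<in> Y \<Longrightarrow> z \<notin> S \<Longrightarrow> big z"
    and p: "p \<in> X" "p \<notin> S" "E p (f u)"
  shows "\<not> E u (f p)" and "E (f p) u"
proof -
  have uX: "u \<in> X" "u \<in> S" using u by auto
  show n: "\<not> E u (f p)" using no_merge'[OF cl, of u p] uX p by auto
  have "f p \<in> Y" "big (f p)" using big[of "f p"] f_X closed_f_notin[OF cl, of p] p by auto
  then show "E (f p) u"
    using bipartite_arcs.big_miss_out_in[OF swap, of "f p" u u] n uX by auto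
qed

lemma two_cycle_others_big:
  assumes "closed S" "S \<inter> X = {u}" "\<And>x. x \<in> X \<Longrightarrow> x \<noteq> x0 \<Longrightarrow> big x"
    and "\<And>x. x \<in> X \<Longrightarrow> degree_in E x \<ge> a + 1" and "degree_in E u \<le> a + 1"
    and v: "v \<in> X" "v \<notin> S"
  shows "big v"
proof (cases "u = x0")
  case True
  then show ?thesis using assms by auto
next
  case False
  then have "big u" using assms by auto
  \<comment> \<open>This forces \<open>a = 2\<close>, where the lower bound \<open>a + 1\<close>
    already makes every vertex of \<open>X\<close> big.\<close>
  then have "2 * a - 1 \<le> a + 1" using assms by linarith
  then show ?thesis using assms(4)[OF v(1)] by linarith
qed

lemma two_cycle:
  assumes cl: "closed S" and u: "S \<inter> X = {u}"
    and uniqX: "\<And>x. x \<in> X \<Longrightarrow> x \<noteq> x0 \<Longrightarrow> big x"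
    and uniqY: "\<And>y. y \<in> Y \<Longrightarrow> y \<noteq> y0 \<Longrightarrow> big y"
    and deg: "\<And>v. v \<in> X \<union> Y \<Longrightarrow> degree_in E v \<ge> a + 1"
  shows False
proof -
  interpret sw: stuck_factor Y X E a f by (rule swap_stuck)
  define w where "w = f u"
  have cl': "sw.closed S" using cl by (auto simp: Un_commute)
  have uX: "u \<in> X" "u \<in> S" using u by auto
  note single = closed_single[OF cl u, folded w_def]
  have wY: "w \<in> Y" "w \<in> S" using uX f_X closed_f[OF cl] by (auto simp: w_def)
  have Sw: "S \<inter> Y = {w}" using single uX wY disjoint by auto
  have "card {y \<in> Y. \<not> E u y} + card {y \<in> Y. \<not> E y u} + degree_in E u = 2 * a"
    by (rule card_miss[OF uX(1)])
  moreover have "card {x \<in> X. \<not> E w x} + card {x \<in> X. \<not> E x w} + degree_in E w = 2 * a"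
    by (rule sw.card_miss[OF wY(1)])
  moreover have "a - 1 \<le> card {y \<in> Y. \<not> E u y} + card {x \<in> X. \<not> E x w}"
    using two_cycle_miss[OF cl u] by (simp add: w_def)
  moreover have "a - 1 \<le> card {x \<in> X. \<not> E w x} + card {y \<in> Y. \<not> E y u}"
    using sw.two_cycle_miss[OF cl' Sw] by (simp add: single)
  \<comment> \<open>\<open>u\<close> and \<open>w\<close> miss at most \<open>a - 1\<close> arcs
    each, but at least \<open>2 * (a - 1)\<close> together, so equality holds.\<close>
  ultimately have "degree_in E u \<le> a + 1" "degree_in E w \<le> a + 1"
    using deg[of u] deg[of w] uX wY by auto
  then have bigX: "big v" if "v \<in> X" "v \<notin> S" for v
    using two_cycle_others_big[OF cl u uniqX deg] that by auto
  have bigY: "big v" if "v \<in> Y" "v \<notin> S" for v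
    using sw.two_cycle_others_big[OF cl' Sw uniqY deg] \<open>degree_in E w \<le> a + 1\<close> that by auto
  have stepX: "\<not> E u (f p)" "E (f p) u" if "p \<in> X" "p \<notin> S" "E p w" for p
    using two_cycle_step[OF cl u bigY that(1,2)] that(3) by (auto simp: w_def)
  have stepY: "\<not> E w (f p)" "E (f p) w" if "p \<in> Y" "p \<notin> S" "E p u" for p
    using sw.two_cycle_step[OF cl' Sw bigX that(1,2)] that(3) by (auto simp: single)
  \<comment> \<open>The vertices outside the 2-cycle with an arc into it. The steps above make
    \<open>R\<close> closed and, as each member has its predecessor in \<open>R\<close>, exclude
    arcs from \<open>S\<close> to \<open>R\<close>.\<close>
  define R where "R = {p \<in> X \<union> Y - S. E p u \<or> E p w}"
  have RX: "p \<in> R \<longleftrightarrow> E p w" if "p \<in> X" "p \<notin> S" for p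
    using that uX disjoint arc_sides unfolding R_def by blast
  have RY: "p \<in> R \<longleftrightarrow> E p u" if "p \<in> Y" "p \<notin> S" for p
    using that wY disjoint arc_sides unfolding R_def by blast
  have clR: "closed R"
    unfolding closed_sets_def
  proof (intro CollectI conjI subsetI)
    fix q assume "q \<in> f ` R"
    then obtain p where p: "p \<in> R" "q = f p" by auto
    have pS: "p \<in> X \<union> Y" "p \<notin> S" using p by (auto simp: R_def)
    then have fp: "f p \<notin> S" by (rule closed_f_notin[OF cl])
    show "q \<in> R"
    proof (cases "p \<in> X")
      case True
      then show ?thesis using RX[of p] RY[of "f p"] stepX[of p] p pS fp f_X by auto
    next
      case False
      then show ?thesis using RY[of p] RX[of "f p"] stepY[of p] p pS fp f_Y by auto
    qed
  qed (auto simp: R_def)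
  have no_arc_R: "\<not> E p q" if pq: "p \<in> S" "q \<in> R" for p q
  proof -
    obtain q' where q': "q' \<in> R" "q = f q'" using closed_image[OF clR] pq(2) by (metis imageE)
    have q'S: "q' \<in> X \<union> Y" "q' \<notin> S" using q' by (auto simp: R_def)
    show ?thesis
    proof (cases "q' \<in> X")
      case True
      then have "\<not> E u q" "q \<in> Y" using RX[of q'] stepX[of q'] q' q'S f_X by auto
      then show ?thesis using pq single(2) wY disjoint arc_sides by blast
    next
      case False
      then have "\<not> E w q" "q \<in> X" using RY[of q'] stepY[of q'] q' q'S f_Y by auto
      then show ?thesis using pq single(2) uX disjoint arc_sides by blast
    qed
  qed
  have "\<not> Y \<subseteq> {w}" using card_mono[of "{w}" Y] card_Y a_ge_2 by auto
  then have propS: "proper S" using cl uX Sw unfolding proper_def by auto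
  obtain p q where "p \<in> X \<union> Y - S" "q \<in> S" "E p q"
    using leaving_arc[of "X \<union> Y - S"] proper_compl[OF propS] closed_subset[OF cl]
    by (auto simp: proper_def)
  then have "p \<in> R" unfolding R_def using single(2) by auto
  then obtain v where v: "v \<in> R" "v \<in> X"
    using closed_f[OF clR, of p] f_Y[of p] by (auto simp: R_def)
  have vS: "v \<notin> S" using v by (auto simp: R_def)
  obtain p' q' where pq': "p' \<in> S" "q' \<in> X \<union> Y - S" "E p' q'"
    using leaving_arc[of S] propS closed_subset[OF cl] by (auto simp: proper_def)
  have "q' \<in> X \<union> Y" "q' \<notin> R" "q' \<notin> S" using no_arc_R pq' by auto
  then obtain v' where v': "v' \<notin> R" "v' \<notin> S" "v' \<in> X"
    using closed_f_notin[OF clR, of q'] closed_f_notin[OF cl, of q'] f_Y[of q'] by blast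
  \<comment> \<open>\<open>v\<close> already misses the arc from \<open>w\<close>, and
    \<open>v'\<close> the arc to \<open>w\<close>. Neither can miss another, so both exchange arcs
    exist and \<open>R\<close> separates \<open>v\<close> from \<open>v'\<close>.\<close>
  have "E v (f v')"
    using big_miss_out_in[OF v(2) bigX[OF v(2) vS] f_X[OF v'(3)] wY(1)] no_arc_R[OF wY(2) v(1)]
    by blast
  moreover have "\<not> E v' w" using RX v' by auto
  moreover have "f v \<noteq> w" using f_eqD[of v u] v vS uX by (auto simp: w_def)
  ultimately show False
    using no_merge'[OF clR v(2) v'(3)] v v' bigX[OF v'(3,2)]
      big_miss_out[OF v'(3) _ f_X[OF v(2)] wY(1)] by blast
qed

text \<open>Counted at the vertices of \<open>X\<close>, at most \<open>(a - 1) + (a - 1)\<close>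
  arcs are missing: those at \<open>x0\<close> and one for each other vertex. Each direction needs
  as many as the product of the sizes of the two parts of \<open>X\<close>.\<close>

lemma one_small_each_side:
  assumes S: "proper S" and x0: "x0 \<in> X"
    and uniqX: "\<And>x. x \<in> X \<Longrightarrow> x \<noteq> x0 \<Longrightarrow> big x"
    and uniqY: "\<And>y. y \<in> Y \<Longrightarrow> y \<noteq> y0 \<Longrightarrow> big y"
    and deg: "\<And>v. v \<in> X \<union> Y \<Longrightarrow> degree_in E v \<ge> a + 1"
  shows False
proof -
  interpret sw: stuck_factor Y X E a f by (rule swap_stuck)
  have cl: "closed S" and cl': "sw.closed S" using S by (auto simp: proper_def Un_commute)
  let ?m = "\<lambda>x. card {y \<in> Y. \<not> E x y} + card {y \<in> Y. \<not> E y x}"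
  have "?m x \<le> 1" if "x \<in> X - {x0}" for x
    using card_miss[of x] uniqX[of x] that by auto
  then have "sum ?m (X - {x0}) \<le> card (X - {x0}) * 1"
    using sum_bounded_above[of "X - {x0}" ?m 1] by simp
  moreover have "?m x0 \<le> a - 1" using card_miss[OF x0] deg[of x0] x0 by auto
  moreover have "sum ?m X = ?m x0 + sum ?m (X - {x0})" using finite_X x0 by (rule sum.remove)
  ultimately have le: "sum ?m X \<le> 2 * (a - 1)" using card_X finite_X x0 by simp
  have "card (SIGMA y:Y. {x \<in> X. \<not> E y x}) = card (SIGMA x:X. {y \<in> Y. \<not> E y x})"
    by (rule bij_betw_same_card[of prod.swap]) (auto simp: bij_betw_def inj_on_def image_iff)
  then have "sum ?m X = card (SIGMA x:X. {y \<in> Y. \<not> E x y}) + card (SIGMA y:Y. {x \<in> X. \<not> E y x})"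
    using finite_X finite_Y by (simp add: sum.distrib card_SigmaI)
  moreover have sides: "card (S \<inter> Y) = card (S \<inter> X)" "card (Y - S) = card (X - S)"
  proof -
    show "card (S \<inter> Y) = card (S \<inter> X)" by (rule card_closed_sides[OF cl])
    have "Y - S = (X \<union> Y - S) \<inter> Y" "X - S = (X \<union> Y - S) \<inter> X" by auto
    then show "card (Y - S) = card (X - S)" using card_closed_sides[OF closed_compl[OF cl]] by simp
  qed
  ultimately have prod: "card (S \<inter> X) * card (X - S) \<le> a - 1"
    using card_cross_le_miss[OF cl] sw.card_cross_le_miss[OF cl'] le by simp
  have "card (S \<inter> X) + card (X - S) = a"
    using card_X card_Int_Diff[OF finite_X, of S] by (simp add: Int_commute)
  moreover have "card (S \<inter> X) \<ge> 1" "card (X - S) \<ge> 1"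
    using proper_meets[OF S] finite_X by (auto simp: Suc_le_eq card_gt_0_iff)
  \<comment> \<open>Two positive numbers with sum \<open>a\<close> and product at most
    \<open>a - 1\<close> cannot both exceed 1.\<close>
  ultimately have "card (S \<inter> X) = 1 \<or> card (X - S) = 1"
    using prod by (cases "card (S \<inter> X)"; cases "card (X - S)") auto
  moreover have "X - S = (X \<union> Y - S) \<inter> X" by auto
  ultimately obtain T u where "closed T" "T \<inter> X = {u}"
    using cl closed_compl[OF cl] by (metis card_1_singletonE)
  then show False using two_cycle uniqX uniqY deg by blast
qed

lemma not_proper: "\<not> proper S"
proof
  assume S: "proper S"
  interpret sw: stuck_factor Y X E a f by (rule swap_stuck)
  have S': "sw.proper S" using S by (simp add: proper_swap)
  have "X \<noteq> {}" "Y \<noteq> {}" using card_X card_Y a_ge_2 by auto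
  then obtain d e where de: "d \<in> X" "e \<in> Y" by auto
  show False
  \<comment> \<open>The side may also have no small vertex at all; \<open>x0\<close> is then
    arbitrary.\<close>
  proof (cases "\<exists>x0\<in>X. \<forall>x\<in>X. x \<noteq> x0 \<longrightarrow> big x")
    case True
    then obtain x0 where x0: "x0 \<in> X" "\<And>x. x \<in> X \<Longrightarrow> x \<noteq> x0 \<Longrightarrow> big x" by auto
    show False
    proof (cases "\<exists>y0\<in>Y. \<forall>y\<in>Y. y \<noteq> y0 \<longrightarrow> big y")
      case True
      then obtain y0 where y0: "y0 \<in> Y" "\<And>y. y \<in> Y \<Longrightarrow> y \<noteq> y0 \<Longrightarrow> big y" by auto
      have "degree_in E x0 \<ge> a + 1"
        using low_degree[OF S x0(2,1)] by (cases "degree_in E x0 \<le> a") auto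
      moreover have "degree_in E y0 \<ge> a + 1"
        using sw.low_degree[OF S' y0(2,1)] by (cases "degree_in E y0 \<le> a") auto
      ultimately have "degree_in E v \<ge> a + 1" if "v \<in> X \<union> Y" for v
        using that x0(2)[of v] y0(2)[of v] a_ge_2 by (cases "v = x0 \<or> v = y0") auto
      then show False using one_small_each_side[OF S x0 y0(2)] by blast
    next
      case False
      then obtain y1 where y1: "y1 \<in> Y" "\<not> big y1" using de by auto
      then obtain y2 where "y2 \<in> Y" "y2 \<noteq> y1" "\<not> big y2" using False by blast
      then show False using one_small_two_small[OF S x0(2) _ _ _ _ _ x0(1)] y1 by blast
    qed
  next
    case False
    then obtain x1 where x1: "x1 \<in> X" "\<not> big x1" using de by auto
    then obtain x2 where x2: "x2 \<in> X" "x2 \<noteq> x1" "\<not> big x2" using False by blast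
    show False
    proof (cases "\<exists>y0\<in>Y. \<forall>y\<in>Y. y \<noteq> y0 \<longrightarrow> big y")
      case True
      then obtain y0 where y0: "y0 \<in> Y" "\<And>y. y \<in> Y \<Longrightarrow> y \<noteq> y0 \<Longrightarrow> big y" by auto
      then show False using sw.one_small_two_small[OF S' y0(2) _ _ _ _ _ y0(1)] x1 x2 by blast
    next
      case F: False
      then obtain y1 where y1: "y1 \<in> Y" "\<not> big y1" using de by auto
      then obtain y2 where "y2 \<in> Y" "y2 \<noteq> y1" "\<not> big y2" using F by blast
      then show False using two_small_both_sides[OF S] x1 x2 y1 by blast
    qed
  qed
qed

end

section \<open>Hamiltonian cycles\<close>

text \<open>A cycle factor with the fewest closed sets admits no merge, so by
  \<open>not_proper\<close> it is a single cycle.\<close>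

lemma (in bipartite_arcs) ex_hamiltonian_factor:
  "\<exists>f. (\<forall>v\<in>X \<union> Y. f v \<in> X \<union> Y \<and> E v (f v)) \<and>
    (\<forall>S. S \<subseteq> X \<union> Y \<longrightarrow> f ` S \<subseteq> S \<longrightarrow> S \<noteq> {} \<longrightarrow> S = X \<union> Y)"
proof -
  let ?V = "X \<union> Y"
  obtain f0 where "cycle_factor f0" using ex_cycle_factor by auto
  then obtain f where f: "cycle_factor f"
    and min: "\<And>g. cycle_factor g \<Longrightarrow> card (closed_sets ?V f) \<le> card (closed_sets ?V g)"
    using ex_has_least_nat[of cycle_factor f0 "\<lambda>f. card (closed_sets ?V f)"] by auto
  have bij: "bij_betw f X Y" "bij_betw f Y X" and arc: "\<And>v. v \<in> ?V \<Longrightarrow> E v (f v)"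
    using f by (auto simp: cycle_factor_def)
  have inj: "inj_on f ?V" using f by (rule cycle_factor_inj)
  have fV: "f ` ?V \<subseteq> ?V" using bij by (auto simp: bij_betw_def)
  have fin: "finite ?V" using finite_X finite_Y by simp
  interpret stuck_factor X Y E a f
  proof
    show "cycle_factor f" by (rule f)
  next
    fix S u v
    assume S: "S \<in> closed_sets ?V f" and u: "u \<in> S" and v: "v \<in> ?V - S"
      and same: "(u \<in> X) = (v \<in> X)" and uv: "E u (f v)" "E v (f u)"
    let ?t = "Transposition.transpose u v" and ?g = "f \<circ> Transposition.transpose u v"
    have sides: "u \<in> X \<and> v \<in> X \<or> u \<in> Y \<and> v \<in> Y"
      using S u v same by (auto simp: closed_sets_def)
    have "bij_betw ?t X X" "bij_betw ?t Y Y"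
    proof -
      have "?t ` X = X" "?t ` Y = Y"
        using sides disjoint by (auto simp: Transposition.transpose_def image_iff)
      then show "bij_betw ?t X X" "bij_betw ?t Y Y"
        by (auto simp: bij_betw_def intro: inj_on_subset[OF inj_transpose])
    qed
    then have "bij_betw ?g X Y" "bij_betw ?g Y X" using bij bij_betw_trans by blast+
    moreover have "E z (?g z)" if "z \<in> ?V" for z
      using uv arc[OF that] by (auto simp: Transposition.transpose_def)
    ultimately have "cycle_factor ?g" unfolding cycle_factor_def by auto
    moreover have "card (closed_sets ?V ?g) < card (closed_sets ?V f)"
      using closed_sets_transpose[OF fin inj fV S u v] fin
      by (intro psubset_card_mono) (auto simp: closed_sets_def)
    ultimately show False using min by (meson not_le)
  qed
  show ?thesis
  proof (intro exI[of _ f] conjI ballI allI impI)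
    show "S = ?V" if "S \<subseteq> ?V" "f ` S \<subseteq> S" "S \<noteq> {}" for S
      using not_proper[of S] that by (simp add: proper_def closed_sets_def)
  qed (use fV arc in auto)
qed

section \<open>From arc relations back to digraphs\<close>

lemma (in digraph) degree_in_dominates: "degree_in (\<lambda>u v. u \<rightarrow> v) v = vertex_degree G v"
proof -
  have "card {w. v \<rightarrow> w} = card (out_arcs G v)"
    by (rule sym, rule bij_betw_same_card[of "head G"])
      (auto simp: bij_betw_def inj_on_def arcs_ends_conv arc_to_ends_def intro: no_multi_arcs)
  moreover have "card {w. w \<rightarrow> v} = card (in_arcs G v)"
    by (rule sym, rule bij_betw_same_card[of "tail G"])
      (auto simp: bij_betw_def inj_on_def arcs_ends_conv arc_to_ends_def intro: no_multi_arcs)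
  ultimately show ?thesis
    by (simp add: degree_in_def vertex_degree_def out_degree_def in_degree_def)
qed

lemma (in wf_digraph) strongly_connected_leaving:
  assumes "strongly_connected G" "S \<subseteq> verts G" "S \<noteq> {}" "S \<noteq> verts G"
  shows "\<exists>u\<in>S. \<exists>v\<in>verts G - S. u \<rightarrow> v"
proof (rule ccontr)
  assume no: "\<not> ?thesis"
  obtain s t where s: "s \<in> S" and t: "t \<in> verts G - S" using assms by auto
  have "s \<rightarrow>\<^sup>* t" using assms s t by (auto simp: strongly_connected_def)
  then have "t \<in> S"
  proof (induct rule: reachable_induct)
    case (step x y)
    then have "y \<in> verts G" by (auto intro: adj_in_verts)
    then show ?case using no step by auto
  qed (use s in simp)
  then show False using t by simp
qed

lemma (in wf_digraph) awalk_iterate: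
  assumes e: "\<And>v. v \<in> verts G \<Longrightarrow> e v \<in> arcs G \<and> tail G (e v) = v \<and> head G (e v) = f v"
    and r: "r \<in> verts G"
  shows "awalk r (map (\<lambda>i. e ((f ^^ i) r)) [0..<n]) ((f ^^ n) r) \<and>
    awalk_verts r (map (\<lambda>i. e ((f ^^ i) r)) [0..<n]) = map (\<lambda>i. (f ^^ i) r) [0..<Suc n]"
proof (induct n)
  case 0
  show ?case using r by (simp add: awalk_Nil_iff)
next
  case (Suc n)
  let ?p = "map (\<lambda>i. e ((f ^^ i) r)) [0..<n]" and ?v = "(f ^^ n) r"
  have v: "?v \<in> verts G" using Suc by auto
  have last: "awlast r ?p = ?v" using Suc by auto
  have step: "awalk ?v [e ?v] (f ?v)" using e[OF v] v head_in_verts[of "e ?v"]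
    by (auto simp: awalk_simps)
  have w: "awalk r (?p @ [e ?v]) (f ?v)" using Suc step by (auto intro: awalk_appendI)
  have "awalk_verts r (?p @ [e ?v]) = awalk_verts r ?p @ tl (awalk_verts ?v [e ?v])"
    using awalk_verts_append[OF w] last by simp
  then show ?case using Suc w e[OF v] by auto
qed

text \<open>The orbit of any vertex is closed, hence everything; following it until the first return
  gives the cycle.\<close>

lemma (in wf_digraph) hamiltonian_iterate:
  assumes fin: "finite (verts G)" and ne: "verts G \<noteq> {}"
    and f: "\<And>v. v \<in> verts G \<Longrightarrow> f v \<in> verts G \<and> v \<rightarrow> f v"
    and minimal: "\<And>S. S \<subseteq> verts G \<Longrightarrow> f ` S \<subseteq> S \<Longrightarrow> S \<noteq> {} \<Longrightarrow> S = verts G"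
  shows "hamiltonian G"
proof -
  obtain r where r: "r \<in> verts G" using ne by auto
  have sub: "orbit f r \<subseteq> verts G"
  proof
    fix x assume "x \<in> orbit f r"
    then show "x \<in> verts G" by induct (use r f in auto)
  qed
  have orb: "orbit f r = verts G"
  proof (rule minimal)
    show "f ` orbit f r \<subseteq> orbit f r" by (auto intro: orbit.intros)
    show "orbit f r \<noteq> {}" using orbit.base[of f r] by auto
  qed (rule sub)
  \<comment> \<open>The least positive return time, so the iterates below \<open>n\<close> are
    distinct.\<close>
  define n where "n = funpow_dist1 f r r"
  have self: "r \<in> orbit f r" using r orb by simp
  have ret: "(f ^^ n) r = r" using funpow_dist1_prop[OF self] by (simp add: n_def)
  have n0: "n > 0" by (simp add: n_def)
  have all: "verts G = (\<lambda>i. (f ^^ i) r) ` {0..<n}"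
    using orbit_conv_funpow_dist1[OF self] orb by (simp add: n_def)
  have inj: "inj_on (\<lambda>i. (f ^^ i) r) {0..<n}"
    using inj_on_funpow_dist1[OF self] by (simp add: n_def)
  have "\<forall>v\<in>verts G. \<exists>e. e \<in> arcs G \<and> tail G e = v \<and> head G e = f v"
    using f by (meson reachableE)
  then obtain e where e: "\<And>v. v \<in> verts G \<Longrightarrow> e v \<in> arcs G \<and> tail G (e v) = v \<and> head G (e v) = f v"
    by metis
  let ?p = "map (\<lambda>i. e ((f ^^ i) r)) [0..<n]"
  have walk: "awalk r ?p r"
    and verts: "awalk_verts r ?p = map (\<lambda>i. (f ^^ i) r) [0..<n] @ [r]"
    using awalk_iterate[of e f r n, OF e r] ret by auto
  have upt: "[0..<n] = 0 # [Suc 0..<n]" using n0 by (rule upt_conv_Cons)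
  have tl: "tl (awalk_verts r ?p) = map (\<lambda>i. (f ^^ i) r) [Suc 0..<n] @ [r]"
    unfolding verts unfolding upt by simp
  have "distinct (map (\<lambda>i. (f ^^ i) r) [0..<n])" using inj by (simp add: distinct_map)
  then have "distinct (map (\<lambda>i. (f ^^ i) r) (0 # [Suc 0..<n]))" unfolding upt .
  then have "distinct (tl (awalk_verts r ?p))" unfolding tl by auto
  then have "cycle ?p" unfolding cycle_def using walk n0 by auto
  moreover have "set (awalk_verts r ?p) = verts G"
    unfolding verts using all r by auto
  ultimately show ?thesis unfolding hamiltonian_def using walk by blast
qed

theorem theorem1p6:
  fixes D :: "('v, 'e) pre_digraph" and a :: nat
  assumes "a \<ge> 2"
    and "digraph D"
    and "strongly_connected D"
    and "balanced_bipartite D"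
    and "card (verts D) = 2 * a"
    and "\<And>x y. dominating_pair D x y \<Longrightarrow>
           (vertex_degree D x \<ge> 2 * a - 1 \<and> vertex_degree D y \<ge> a + 1) \<or>
           (vertex_degree D y \<ge> 2 * a - 1 \<and> vertex_degree D x \<ge> a + 1)"
  shows "hamiltonian D"
proof -
  interpret digraph D by (rule assms(2))
  obtain V1 V2 where part: "partite_sets D V1 V2" and card: "card V1 = card V2"
    using assms(4) by (auto simp: balanced_bipartite_def)
  have V: "verts D = V1 \<union> V2" "V1 \<inter> V2 = {}"
    and ind: "\<And>x y. x \<in> V1 \<Longrightarrow> y \<in> V1 \<Longrightarrow> \<not> x \<rightarrow>\<^bsub>D\<^esub> y" "\<And>x y. x \<in> V2 \<Longrightarrow> y \<in> V2 \<Longrightarrow> \<not> x \<rightarrow>\<^bsub>D\<^esub> y"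
    using part by (auto simp: partite_sets_def independent_set_def)
  have fin: "finite V1" "finite V2" using finite_verts V by (metis finite_Un)+
  have cards: "card V1 = a" "card V2 = a"
    using card_Un_disjoint[OF fin V(2)] V card assms(5) by auto
  interpret B: bipartite_arcs V1 V2 "\<lambda>u v. u \<rightarrow>\<^bsub>D\<^esub> v" a
  proof
    show "(u \<in> V1 \<and> v \<in> V2) \<or> (u \<in> V2 \<and> v \<in> V1)" if "u \<rightarrow>\<^bsub>D\<^esub> v" for u v
      using adj_in_verts[OF that] ind that V by blast
    show "\<exists>u\<in>S. \<exists>v\<in>V1 \<union> V2 - S. u \<rightarrow>\<^bsub>D\<^esub> v"
      if "S \<subseteq> V1 \<union> V2" "S \<noteq> {}" "S \<noteq> V1 \<union> V2" for S
      using strongly_connected_leaving[OF assms(3)] that V by simp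
    fix u v w assume "u \<noteq> v" "u \<rightarrow>\<^bsub>D\<^esub> w" "v \<rightarrow>\<^bsub>D\<^esub> w"
    then have "dominating_pair D u v"
      using adj_in_verts unfolding dominating_pair_def by blast
    then show "(2 * a - 1 \<le> degree_in (dominates D) u \<and> a + 1 \<le> degree_in (dominates D) v) \<or>
        (2 * a - 1 \<le> degree_in (dominates D) v \<and> a + 1 \<le> degree_in (dominates D) u)"
      using assms(6) by (simp add: degree_in_dominates)
  qed (use fin V cards assms(1) in auto)
  obtain f where f: "\<forall>v\<in>V1 \<union> V2. f v \<in> V1 \<union> V2 \<and> v \<rightarrow>\<^bsub>D\<^esub> f v"
    and minimal: "\<forall>S. S \<subseteq> V1 \<union> V2 \<longrightarrow> f ` S \<subseteq> S \<longrightarrow> S \<noteq> {} \<longrightarrow> S = V1 \<union> V2"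
    using B.ex_hamiltonian_factor by blast
  show ?thesis
  proof (rule hamiltonian_iterate)
    show "verts D \<noteq> {}" using assms(3) by (simp add: strongly_connected_def)
    show "f v \<in> verts D \<and> v \<rightarrow>\<^bsub>D\<^esub> f v" if "v \<in> verts D" for v using f that V by simp
    show "S = verts D" if "S \<subseteq> verts D" "f ` S \<subseteq> S" "S \<noteq> {}" for S
      using minimal that V by simp
  qed (rule finite_verts)
qed

end
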